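(* Every isotope of a noncommutative group is either semi-symmetric or asymmetric (and not both).
   Context: A groupoid $(Q;\cdot)$ is an isotope of a group $(Q;+)$ if there are bijections $\alpha,\beta,\gamma$ of $Q$ with $x\cdot y=\gamma^{-1}(\alpha x+\beta y)$ for all $x,y\in Q$; it is then a quasigroup. For $\sigma\in S_3$, the $\sigma$-parastrophe of a quasigroup operation $(\cdot)$ is defined by $x_{1\sigma}\stackrel{\sigma}{\cdot}x_{2\sigma}=x_{3\sigma}\Leftrightarrow x_1\cdot x_2=x_3$, and $\mathrm{Sym}(\cdot)=\{\sigma\in S_3:(\stackrel{\sigma}{\cdot})=(\cdot)\}$. A quasigroup is semi-symmetric if $\mathrm{Sym}(\cdot)\supseteq A_3$ (equivalently, it satisfies $x\cdot yx=y$), and asymmetric if $\mathrm{Sym}(\cdot)=\{\iota\}$. *)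

theory Defs
  imports "HOL-Algebra.Sym_Groups"
begin

text \<open>
  Operations are total functions on the ambient type; only their restriction to the
  carrier \<open>Q\<close> matters, so equality of operations always means equality on \<open>Q\<close>.
\<close>

definition quasigroup :: "'a set \<Rightarrow> ('a \<Rightarrow> 'a \<Rightarrow> 'a) \<Rightarrow> bool" where
  "quasigroup Q f \<longleftrightarrow>
     (\<forall>x\<in>Q. \<forall>y\<in>Q. f x y \<in> Q) \<and>
     (\<forall>a\<in>Q. \<forall>b\<in>Q. \<exists>!x. x \<in> Q \<and> f x a = b) \<and>
     (\<forall>a\<in>Q. \<forall>b\<in>Q. \<exists>!y. y \<in> Q \<and> f a y = b)"

definition group_isotope :: "('a, 'b) monoid_scheme \<Rightarrow> ('a \<Rightarrow> 'a \<Rightarrow> 'a) \<Rightarrow> bool" where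
  "group_isotope G f \<longleftrightarrow>
     (\<exists>\<alpha> \<beta> \<gamma>.
        bij_betw \<alpha> (carrier G) (carrier G) \<and>
        bij_betw \<beta> (carrier G) (carrier G) \<and>
        bij_betw \<gamma> (carrier G) (carrier G) \<and>
        (\<forall>x\<in>carrier G. \<forall>y\<in>carrier G.
           f x y = inv_into (carrier G) \<gamma> (\<alpha> x \<otimes>\<^bsub>G\<^esub> \<beta> y)))"

text \<open>
  A triple \<open>(x\<^sub>1, x\<^sub>2, x\<^sub>3)\<close> is a function \<open>x\<close> on \<open>{1..3}\<close>, and \<open>i\<sigma>\<close> is \<open>\<sigma> i\<close>. The defining
  equivalence of the parastrophe is lemma \<open>parastrophe_iff\<close> below.
\<close>

definition parastrophe ::
    "'a set \<Rightarrow> ('a \<Rightarrow> 'a \<Rightarrow> 'a) \<Rightarrow> (nat \<Rightarrow> nat) \<Rightarrow> 'a \<Rightarrow> 'a \<Rightarrow> 'a" where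
  "parastrophe Q f \<sigma> u v =
     (THE w. \<exists>x \<in> {1..3} \<rightarrow> Q.
        x (\<sigma> 1) = u \<and> x (\<sigma> 2) = v \<and> x (\<sigma> 3) = w \<and> f (x 1) (x 2) = x 3)"

definition parastrophic_sym :: "'a set \<Rightarrow> ('a \<Rightarrow> 'a \<Rightarrow> 'a) \<Rightarrow> (nat \<Rightarrow> nat) set" where
  "parastrophic_sym Q f =
     {\<sigma> \<in> carrier (sym_group 3). \<forall>u\<in>Q. \<forall>v\<in>Q. parastrophe Q f \<sigma> u v = f u v}"

definition semi_symmetric :: "'a set \<Rightarrow> ('a \<Rightarrow> 'a \<Rightarrow> 'a) \<Rightarrow> bool" where
  "semi_symmetric Q f \<longleftrightarrow>
     quasigroup Q f \<and> carrier (alt_group 3) \<subseteq> parastrophic_sym Q f"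

definition asymmetric :: "'a set \<Rightarrow> ('a \<Rightarrow> 'a \<Rightarrow> 'a) \<Rightarrow> bool" where
  "asymmetric Q f \<longleftrightarrow> quasigroup Q f \<and> parastrophic_sym Q f = {id}"

lemma quasigroup_if_group_isotope:
  assumes "group G" "group_isotope G f"
  shows "quasigroup (carrier G) f"
proof -
  interpret group G by fact
  let ?Q = "carrier G"
  obtain \<alpha> \<beta> \<gamma> where b: "bij_betw \<alpha> ?Q ?Q" "bij_betw \<beta> ?Q ?Q" "bij_betw \<gamma> ?Q ?Q"
    and f: "\<And>x y. x \<in> ?Q \<Longrightarrow> y \<in> ?Q \<Longrightarrow> f x y = inv_into ?Q \<gamma> (\<alpha> x \<otimes>\<^bsub>G\<^esub> \<beta> y)"
    using assms(2) unfolding group_isotope_def by blast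
  have cl: "\<alpha> x \<in> ?Q" "\<beta> x \<in> ?Q" "\<gamma> x \<in> ?Q" if "x \<in> ?Q" for x
    using b that by (auto dest: bij_betwE)
  have ex: "\<exists>!x. x \<in> ?Q \<and> \<delta> x = c" if d: "bij_betw \<delta> ?Q ?Q" "c \<in> ?Q" for \<delta> c
  proof -
    obtain x where "x \<in> ?Q" "\<delta> x = c"
      using d(2) bij_betw_imp_surj_on[OF d(1)] by (metis imageE)
    moreover have "y = x" if "y \<in> ?Q" "\<delta> y = c" for y
      using inj_onD[OF bij_betw_imp_inj_on[OF d(1)], of y x] that calculation by simp
    ultimately show ?thesis by blast
  qed
  have closed: "f x y \<in> ?Q" if "x \<in> ?Q" "y \<in> ?Q" for x y
    unfolding f[OF that] by (rule inv_into_into) (use b(3) cl that in \<open>simp add: bij_betw_def\<close>)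
  have iff: "f x y = z \<longleftrightarrow> \<alpha> x \<otimes>\<^bsub>G\<^esub> \<beta> y = \<gamma> z" if "x \<in> ?Q" "y \<in> ?Q" "z \<in> ?Q" for x y z
    unfolding f[OF that(1,2)]
    using bij_betw_inv_into_left[OF b(3) that(3)]
      bij_betw_inv_into_right[OF b(3) m_closed[OF cl(1)[OF that(1)] cl(2)[OF that(2)]]]
    by auto
  have "\<exists>!x. x \<in> ?Q \<and> f x a = c" if ac: "a \<in> ?Q" "c \<in> ?Q" for a c
  proof -
    have "f x a = c \<longleftrightarrow> \<alpha> x = \<gamma> c \<otimes>\<^bsub>G\<^esub> inv\<^bsub>G\<^esub> (\<beta> a)" if "x \<in> ?Q" for x
      unfolding iff[OF that ac]
        inv_solve_right[OF cl(1)[OF that] cl(3)[OF ac(2)] cl(2)[OF ac(1)]]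
      by (rule eq_commute)
    then have "x \<in> ?Q \<and> f x a = c \<longleftrightarrow> x \<in> ?Q \<and> \<alpha> x = \<gamma> c \<otimes>\<^bsub>G\<^esub> inv\<^bsub>G\<^esub> (\<beta> a)" for x
      by blast
    with ex[OF b(1), of "\<gamma> c \<otimes>\<^bsub>G\<^esub> inv\<^bsub>G\<^esub> (\<beta> a)"] cl ac show ?thesis
      by (simp only: inv_closed m_closed)
  qed
  moreover have "\<exists>!y. y \<in> ?Q \<and> f a y = c" if ac: "a \<in> ?Q" "c \<in> ?Q" for a c
  proof -
    have "f a y = c \<longleftrightarrow> \<beta> y = inv\<^bsub>G\<^esub> (\<alpha> a) \<otimes>\<^bsub>G\<^esub> \<gamma> c" if "y \<in> ?Q" for y
      unfolding iff[OF ac(1) that ac(2)]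
        inv_solve_left[OF cl(2)[OF that] cl(1)[OF ac(1)] cl(3)[OF ac(2)]]
      by (rule eq_commute)
    then have "y \<in> ?Q \<and> f a y = c \<longleftrightarrow> y \<in> ?Q \<and> \<beta> y = inv\<^bsub>G\<^esub> (\<alpha> a) \<otimes>\<^bsub>G\<^esub> \<gamma> c" for y
      by blast
    with ex[OF b(2), of "inv\<^bsub>G\<^esub> (\<alpha> a) \<otimes>\<^bsub>G\<^esub> \<gamma> c"] cl ac show ?thesis
      by (simp only: inv_closed m_closed)
  qed
  ultimately show ?thesis
    unfolding quasigroup_def by (intro conjI ballI closed)
qed

lemma parastrophe_iff:
  assumes Q: "quasigroup Q f" and \<sigma>: "\<sigma> \<in> carrier (sym_group 3)" and x: "x \<in> {1..3} \<rightarrow> Q"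
  shows "parastrophe Q f \<sigma> (x (\<sigma> 1)) (x (\<sigma> 2)) = x (\<sigma> 3) \<longleftrightarrow> f (x 1) (x 2) = x 3"
proof -
  have S: "{1..3::nat} = {1, 2, 3}" by auto
  have p: "\<sigma> permutes {1, 2, 3}" using \<sigma> S by (simp add: sym_group_carrier)
  have im: "{\<sigma> 1, \<sigma> 2, \<sigma> 3} = {1, 2, 3}" using permutes_image[OF p] by auto
  have i3: "\<sigma> 3 \<in> {1, 2, 3}" using im by auto
  have neq: "\<sigma> 1 \<noteq> \<sigma> 3" "\<sigma> 2 \<noteq> \<sigma> 3"
    using permutes_inj[OF p] by (simp_all add: inj_eq)
  let ?u = "x (\<sigma> 1)" and ?v = "x (\<sigma> 2)"
  let ?P = "\<lambda>w. \<exists>y \<in> {1..3} \<rightarrow> Q.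
        y (\<sigma> 1) = ?u \<and> y (\<sigma> 2) = ?v \<and> y (\<sigma> 3) = w \<and> f (y 1) (y 2) = y 3"
  have x': "x 1 \<in> Q" "x 2 \<in> Q" "x 3 \<in> Q" using x by auto
  define R where "R w \<longleftrightarrow> (let y = x(\<sigma> 3 := w) in f (y 1) (y 2) = y 3)" for w
  have PR: "?P w \<longleftrightarrow> w \<in> Q \<and> R w" for w
  proof
    assume "?P w"
    then obtain y where y: "y \<in> {1..3} \<rightarrow> Q" "y (\<sigma> 1) = ?u" "y (\<sigma> 2) = ?v" "y (\<sigma> 3) = w"
      "f (y 1) (y 2) = y 3" by blast
    have eq: "y k = (x(\<sigma> 3 := w)) k" if "k \<in> {1, 2, 3}" for k
    proof -
      have "k = \<sigma> 1 \<or> k = \<sigma> 2 \<or> k = \<sigma> 3" using that im by blast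
      then show ?thesis using y(2-4) neq by auto
    qed
    have "w \<in> Q" using y(1,4) i3 by auto
    moreover have "R w"
      unfolding R_def Let_def using eq[of 1] eq[of 2] eq[of 3] y(5) by simp
    ultimately show "w \<in> Q \<and> R w" ..
  next
    assume w: "w \<in> Q \<and> R w"
    show "?P w"
    proof (intro bexI conjI)
      show "x(\<sigma> 3 := w) \<in> {1..3} \<rightarrow> Q" using w x by auto
    qed (use w neq in \<open>auto simp: R_def Let_def\<close>)
  qed
  have "\<exists>!w. w \<in> Q \<and> R w"
  proof -
    consider "\<sigma> 3 = 1" | "\<sigma> 3 = 2" | "\<sigma> 3 = 3" using i3 by blast
    then show ?thesis
    proof cases
      case 1
      then have "R w \<longleftrightarrow> f w (x 2) = x 3" for w by (simp add: R_def)
      then show ?thesis using Q x' unfolding quasigroup_def by simp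
    next
      case 2
      then have "R w \<longleftrightarrow> f (x 1) w = x 3" for w by (simp add: R_def)
      then show ?thesis using Q x' unfolding quasigroup_def by simp
    next
      case 3
      then have "R w \<longleftrightarrow> f (x 1) (x 2) = w" for w by (simp add: R_def)
      then show ?thesis using Q x' unfolding quasigroup_def by auto
    qed
  qed
  note ex1 = this
  have "parastrophe Q f \<sigma> ?u ?v = (THE w. w \<in> Q \<and> R w)"
    unfolding parastrophe_def using PR by simp
  then have "parastrophe Q f \<sigma> ?u ?v = w \<longleftrightarrow> w \<in> Q \<and> R w" for w
    using theI'[OF ex1] the1_equality[OF ex1, of w] by auto
  moreover have "x (\<sigma> 3) \<in> Q" using x i3 by auto
  moreover have "R (x (\<sigma> 3)) \<longleftrightarrow> f (x 1) (x 2) = x 3" by (simp add: R_def)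
  ultimately show ?thesis by blast
qed

end

theory Submission
  imports Defs
begin

text \<open>
  The graph of an isotope is the relation \<open>\<alpha> x \<otimes> \<beta> y \<otimes> \<delta> z = \<one>\<close> with \<open>\<delta> z = inv (\<gamma> z)\<close>, whose
  factors may be rotated cyclically. Hence invariance of the graph under any of the three
  transpositions amounts to interchanging the arguments of the first two factors, which gives
  \<open>\<alpha> x \<otimes> \<beta> y = \<alpha> y \<otimes> \<beta> x\<close>; taking \<open>\<alpha> y = \<one>\<close> shows that \<open>\<beta>\<close> is \<open>\<alpha>\<close> followed by a right
  translation, so the group is commutative. Over a noncommutative group \<open>Sym\<close> thus contains no
  transposition, and being closed under composition it is trivial or contains both 3-cycles.
\<close>

text \<open>Replaces an equality of operations by invariance of the graph of \<open>f\<close>, the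
  set of triples with \<open>f (x 1) (x 2) = x 3\<close>, under permuting coordinates. In this form
  symmetries are easy to compose and to translate into group equations.\<close>

lemma parastrophic_sym_iff:
  assumes Q: "quasigroup Q f" and \<sigma>: "\<sigma> \<in> carrier (sym_group 3)"
  shows "\<sigma> \<in> parastrophic_sym Q f \<longleftrightarrow>
    (\<forall>x \<in> {1..3} \<rightarrow> Q. f (x (\<sigma> 1)) (x (\<sigma> 2)) = x (\<sigma> 3) \<longleftrightarrow> f (x 1) (x 2) = x 3)"
    (is "_ \<longleftrightarrow> ?R")
proof
  have p: "\<sigma> permutes {1..3}" using \<sigma> by (simp add: sym_group_carrier)
  {
    assume S: "\<sigma> \<in> parastrophic_sym Q f"
    show ?R
    proof
      fix x :: "nat \<Rightarrow> _" assume x: "x \<in> {1..3} \<rightarrow> Q"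
      have "x (\<sigma> 1) \<in> Q" "x (\<sigma> 2) \<in> Q"
        using x permutes_in_image[OF p] by (auto simp: Pi_iff)
      then show "f (x (\<sigma> 1)) (x (\<sigma> 2)) = x (\<sigma> 3) \<longleftrightarrow> f (x 1) (x 2) = x 3"
        using S parastrophe_iff[OF Q \<sigma> x] unfolding parastrophic_sym_def by simp
    qed
  }
  assume R: ?R
  have "parastrophe Q f \<sigma> u v = f u v" if uv: "u \<in> Q" "v \<in> Q" for u v
  proof -
    have w: "f u v \<in> Q" using Q uv unfolding quasigroup_def by blast
    \<comment> \<open>The triple has entries \<open>u\<close>, \<open>v\<close>,
      \<open>f u v\<close> at the distinct places \<open>\<sigma> 1\<close>,
      \<open>\<sigma> 2\<close>, \<open>\<sigma> 3\<close>. The left side of \<open>?R\<close> then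
      holds trivially, so the triple itself lies in the graph, and \<open>parastrophe_iff\<close>
      returns the value at \<open>u\<close>, \<open>v\<close>.\<close>
    let ?x = "\<lambda>k. if k = \<sigma> 1 then u else if k = \<sigma> 2 then v else f u v"
    have x: "?x \<in> {1..3} \<rightarrow> Q" using uv w by auto
    have "\<sigma> 1 \<noteq> \<sigma> 2" "\<sigma> 1 \<noteq> \<sigma> 3" "\<sigma> 2 \<noteq> \<sigma> 3"
      using permutes_inj[OF p] by (simp_all add: inj_eq)
    then show ?thesis
      using parastrophe_iff[OF Q \<sigma> x] bspec[OF R x] by simp
  qed
  then show "\<sigma> \<in> parastrophic_sym Q f"
    using \<sigma> unfolding parastrophic_sym_def by blast
qed

lemma id_in_parastrophic_sym:
  assumes "quasigroup Q f"
  shows "id \<in> parastrophic_sym Q f"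
proof -
  have "id \<in> carrier (sym_group 3)"
    by (simp add: sym_group_carrier permutes_id)
  then show ?thesis
    by (simp add: parastrophic_sym_iff[OF assms])
qed

lemma comp_in_parastrophic_sym:
  assumes Q: "quasigroup Q f"
    and \<sigma>: "\<sigma> \<in> parastrophic_sym Q f" and \<tau>: "\<tau> \<in> parastrophic_sym Q f"
  shows "\<sigma> \<circ> \<tau> \<in> parastrophic_sym Q f"
proof -
  have c: "\<sigma> \<in> carrier (sym_group 3)" "\<tau> \<in> carrier (sym_group 3)"
    using \<sigma> \<tau> unfolding parastrophic_sym_def by auto
  then have p: "\<sigma> permutes {1..3}" "\<tau> permutes {1..3}"
    by (simp_all add: sym_group_carrier)
  have "f (x ((\<sigma> \<circ> \<tau>) 1)) (x ((\<sigma> \<circ> \<tau>) 2)) = x ((\<sigma> \<circ> \<tau>) 3) \<longleftrightarrow> f (x 1) (x 2) = x 3"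
    if x: "x \<in> {1..3} \<rightarrow> Q" for x
  proof -
    \<comment> \<open>Invariance under \<open>\<tau>\<close> is used at the already permuted triple
      \<open>x \<circ> \<sigma>\<close>, whose entry at \<open>\<tau> k\<close> is
      \<open>x ((\<sigma> \<circ> \<tau>) k)\<close>.\<close>
    have x': "x \<circ> \<sigma> \<in> {1..3} \<rightarrow> Q"
      using x permutes_in_image[OF p(1)] by (auto simp: Pi_iff)
    show ?thesis
      using bspec[OF \<sigma>[unfolded parastrophic_sym_iff[OF Q c(1)]] x]
        bspec[OF \<tau>[unfolded parastrophic_sym_iff[OF Q c(2)]] x'] by simp
  qed
  moreover have "\<sigma> \<circ> \<tau> \<in> carrier (sym_group 3)"
    using permutes_compose[OF p(2,1)] by (simp add: sym_group_carrier)
  ultimately show ?thesis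
    by (simp add: parastrophic_sym_iff[OF Q])
qed

text \<open>This cycle sends 1 to 2, 2 to 3 and 3 to 1. Written as a product of two transpositions
  it is visibly even.\<close>

abbreviation cycle3 :: "nat \<Rightarrow> nat" where
  "cycle3 \<equiv> transpose 1 2 \<circ> transpose 2 3"

abbreviation cycle3_inv :: "nat \<Rightarrow> nat" where
  "cycle3_inv \<equiv> transpose 2 3 \<circ> transpose 1 2"

text \<open>Lets closure under composition alone pass from either 3-cycle to the other.\<close>

lemma cycle3_square: "cycle3 \<circ> cycle3 = cycle3_inv" "cycle3_inv \<circ> cycle3_inv = cycle3"
  by (auto simp: fun_eq_iff transpose_def)

lemma cycle3_permutes: "cycle3 permutes {1..3}" "cycle3_inv permutes {1..3}"
  by (rule permutes_compose; rule permutes_swap_id; simp)+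

lemma permutes_3_cases:
  fixes \<sigma> :: "nat \<Rightarrow> nat"
  assumes p: "\<sigma> permutes {1..3}"
  shows "\<sigma> \<in> {id, transpose 1 2, transpose 1 3, transpose 2 3, cycle3, cycle3_inv}"
proof -
  have S: "{1..3::nat} = {1, 2, 3}" by auto
  have i: "\<sigma> 1 \<in> {1, 2, 3}" "\<sigma> 2 \<in> {1, 2, 3}" "\<sigma> 3 \<in> {1, 2, 3}"
    using permutes_in_image[OF p] unfolding S by blast+
  have n: "\<sigma> 1 \<noteq> \<sigma> 2" "\<sigma> 1 \<noteq> \<sigma> 3" "\<sigma> 2 \<noteq> \<sigma> 3"
    using permutes_inj[OF p] by (simp_all add: inj_eq)
  \<comment> \<open>Permutations here are functions on all naturals; both fix everything outside
    \<open>{1..3}\<close>, so three values decide equality.\<close>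
  have eq: "\<sigma> = \<tau>" if "\<tau> permutes {1..3}" "\<sigma> 1 = \<tau> 1" "\<sigma> 2 = \<tau> 2" "\<sigma> 3 = \<tau> 3" for \<tau>
  proof
    fix k
    show "\<sigma> k = \<tau> k"
    proof (cases "k \<in> {1..3}")
      case True
      then have "k = 1 \<or> k = 2 \<or> k = 3" by auto
      then show ?thesis using that by auto
    next
      case False
      then show ?thesis using permutes_not_in[OF p] permutes_not_in[OF that(1)] by simp
    qed
  qed
  have perms: "id permutes {1..3::nat}" "transpose 1 2 permutes {1..3::nat}"
    "transpose 1 3 permutes {1..3::nat}" "transpose 2 3 permutes {1..3::nat}"
    "cycle3 permutes {1..3}" "cycle3_inv permutes {1..3}"
    by (simp_all only: permutes_id cycle3_permutes) (rule permutes_swap_id; simp)+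
  \<comment> \<open>Distinctness leaves six of the 27 conceivable value triples.\<close>
  consider "\<sigma> 1 = 1" "\<sigma> 2 = 2" "\<sigma> 3 = 3" |
    "\<sigma> 1 = 2" "\<sigma> 2 = 1" "\<sigma> 3 = 3" |
    "\<sigma> 1 = 3" "\<sigma> 2 = 2" "\<sigma> 3 = 1" |
    "\<sigma> 1 = 1" "\<sigma> 2 = 3" "\<sigma> 3 = 2" |
    "\<sigma> 1 = 2" "\<sigma> 2 = 3" "\<sigma> 3 = 1" |
    "\<sigma> 1 = 3" "\<sigma> 2 = 1" "\<sigma> 3 = 2"
    using i n by auto
  then show ?thesis
  proof cases
    case 1
    then have "\<sigma> = id" by (intro eq[OF perms(1)]) (simp_all add: transpose_def)
    then show ?thesis by blast
  next
    case 2
    then have "\<sigma> = transpose 1 2" by (intro eq[OF perms(2)]) (simp_all add: transpose_def)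
    then show ?thesis by blast
  next
    case 3
    then have "\<sigma> = transpose 1 3" by (intro eq[OF perms(3)]) (simp_all add: transpose_def)
    then show ?thesis by blast
  next
    case 4
    then have "\<sigma> = transpose 2 3" by (intro eq[OF perms(4)]) (simp_all add: transpose_def)
    then show ?thesis by blast
  next
    case 5
    then have "\<sigma> = cycle3" by (intro eq[OF perms(5)]) (simp_all add: transpose_def)
    then show ?thesis by blast
  next
    case 6
    then have "\<sigma> = cycle3_inv" by (intro eq[OF perms(6)]) (simp_all add: transpose_def)
    then show ?thesis by blast
  qed
qed

lemma transpose_not_in_alt_group:
  assumes "i \<noteq> j"
  shows "transpose i j \<notin> carrier (alt_group n)"
  using assms by (simp add: alt_group_carrier evenperm_swap)

text \<open>Of the six permutations of three letters, the three transpositions are odd and drop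
  out.\<close>

lemma alt_group_3: "carrier (alt_group 3) = {id, cycle3, cycle3_inv}"
proof
  show "carrier (alt_group 3) \<subseteq> {id, cycle3, cycle3_inv}"
  proof
    fix \<sigma> assume \<sigma>: "\<sigma> \<in> carrier (alt_group 3)"
    then have "\<sigma> permutes {1..3}" by (simp add: alt_group_carrier)
    from permutes_3_cases[OF this] \<sigma> show "\<sigma> \<in> {id, cycle3, cycle3_inv}"
      using transpose_not_in_alt_group by auto
  qed
  show "{id, cycle3, cycle3_inv} \<subseteq> carrier (alt_group 3)"
    by (simp add: alt_group_carrier evenperm_comp evenperm_swap permutation_swap_id
        cycle3_permutes[simplified] permutes_id)
qed

text \<open>Stated for arbitrary factors so that one argument serves all three transpositions: it is
  later applied to each cyclic rotation of the maps of the isotopy.\<close>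

lemma (in group) comm_group_if_interchange:
  assumes \<alpha>: "\<alpha> ` carrier G = carrier G" and \<beta>: "\<beta> \<in> carrier G \<rightarrow> carrier G"
    and \<delta>: "\<delta> ` carrier G = carrier G"
    and interchange: "\<And>x y z. x \<in> carrier G \<Longrightarrow> y \<in> carrier G \<Longrightarrow> z \<in> carrier G \<Longrightarrow>
      \<alpha> x \<otimes> \<beta> y \<otimes> \<delta> z = \<one> \<Longrightarrow> \<alpha> y \<otimes> \<beta> x \<otimes> \<delta> z = \<one>"
  shows "comm_group G"
proof -
  have cl: "\<alpha> x \<in> carrier G" "\<beta> x \<in> carrier G" "\<delta> x \<in> carrier G" if "x \<in> carrier G" for x
    using that \<alpha> \<beta> \<delta> by auto
  have swap: "\<alpha> x \<otimes> \<beta> y = \<alpha> y \<otimes> \<beta> x" if xy: "x \<in> carrier G" "y \<in> carrier G" for x y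
  proof -
    \<comment> \<open>Surjectivity of \<open>\<delta>\<close> supplies a \<open>z\<close> that
      cancels the first product, which turns the interchange of vanishing products into an equation
      without \<open>z\<close>.\<close>
    have "inv (\<alpha> x \<otimes> \<beta> y) \<in> \<delta> ` carrier G" using xy cl \<delta> by simp
    then obtain z where z: "z \<in> carrier G" "\<delta> z = inv (\<alpha> x \<otimes> \<beta> y)" by auto
    have "\<alpha> x \<otimes> \<beta> y \<otimes> \<delta> z = \<one>" using z xy cl by simp
    from interchange[OF xy z(1) this] have "\<alpha> y \<otimes> \<beta> x \<otimes> inv (\<alpha> x \<otimes> \<beta> y) = \<one>"
      unfolding z(2) .
    then show ?thesis
      using xy cl by (metis inv_equality inv_inv inv_closed m_closed)
  qed
  have "\<one> \<in> \<alpha> ` carrier G" using \<alpha> by simp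
  then obtain e where e: "e \<in> carrier G" "\<alpha> e = \<one>" by auto
  \<comment> \<open>This is \<open>swap\<close> at \<open>y = e\<close>, where the factor
    \<open>\<alpha> e\<close> disappears.\<close>
  have b: "\<beta> x = \<alpha> x \<otimes> \<beta> e" if "x \<in> carrier G" for x
    using swap[OF that e(1)] e cl that by simp
  show ?thesis
  proof (rule group_comm_groupI)
    fix p q assume pq: "p \<in> carrier G" "q \<in> carrier G"
    then have "p \<in> \<alpha> ` carrier G" "q \<in> \<alpha> ` carrier G" using \<alpha> by simp_all
    then obtain x y where xy: "x \<in> carrier G" "p = \<alpha> x" "y \<in> carrier G" "q = \<alpha> y"
      by (elim imageE)
    \<comment> \<open>Substituting the formula for \<open>\<beta>\<close> into \<open>swap\<close>
      leaves the same right factor \<open>\<beta> e\<close> on both sides, ready to be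
      cancelled.\<close>
    have "p \<otimes> q \<otimes> \<beta> e = q \<otimes> p \<otimes> \<beta> e"
      using swap[OF xy(1,3), unfolded b[OF xy(1)] b[OF xy(3)], folded xy(2,4)] pq cl(2)[OF e(1)]
      by (simp add: m_assoc)
    then show "p \<otimes> q = q \<otimes> p" using pq cl e by simp
  qed
qed

text \<open>Either equation says that \<open>a\<close> and \<open>b \<otimes> c\<close> are mutually
  inverse, since one-sided inverses in a group are two-sided.\<close>

lemma (in group) mult_eq_one_rotate:
  assumes "a \<in> carrier G" "b \<in> carrier G" "c \<in> carrier G"
  shows "a \<otimes> b \<otimes> c = \<one> \<longleftrightarrow> b \<otimes> c \<otimes> a = \<one>"
  using assms by (metis inv_comm m_assoc m_closed)

lemma transposition_not_in_parastrophic_sym: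
  assumes G: "group G" and nc: "\<not> comm_group G" and iso: "group_isotope G f"
    and ij: "(i, j) \<in> {(1, 2), (1, 3), (2, 3)}"
  shows "transpose i j \<notin> parastrophic_sym (carrier G) f"
proof
  interpret group G by (rule G)
  let ?Q = "carrier G"
  have Q: "quasigroup ?Q f" using quasigroup_if_group_isotope[OF G iso] .
  assume S: "transpose i j \<in> parastrophic_sym ?Q f"
  then have "transpose i j \<in> carrier (sym_group 3)" unfolding parastrophic_sym_def by simp
  note T = S[unfolded parastrophic_sym_iff[OF Q this]]
  obtain \<alpha> \<beta> \<gamma> where \<alpha>: "bij_betw \<alpha> ?Q ?Q" and \<beta>: "bij_betw \<beta> ?Q ?Q" and \<gamma>: "bij_betw \<gamma> ?Q ?Q"
    and f: "\<And>x y. x \<in> ?Q \<Longrightarrow> y \<in> ?Q \<Longrightarrow> f x y = inv_into ?Q \<gamma> (\<alpha> x \<otimes>\<^bsub>G\<^esub> \<beta> y)"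
    using iso unfolding group_isotope_def by blast
  define \<delta> where "\<delta> z = inv\<^bsub>G\<^esub> (\<gamma> z)" for z
  have im: "\<alpha> ` ?Q = ?Q" "\<beta> ` ?Q = ?Q" "\<gamma> ` ?Q = ?Q"
    using \<alpha> \<beta> \<gamma> by (auto simp: bij_betw_def)
  then have cl: "\<alpha> x \<in> ?Q" "\<beta> x \<in> ?Q" "\<gamma> x \<in> ?Q" "\<delta> x \<in> ?Q" if "x \<in> ?Q" for x
    using that by (auto simp: \<delta>_def)
  have im\<delta>: "\<delta> ` ?Q = ?Q"
  proof
    show "?Q \<subseteq> \<delta> ` ?Q"
    proof
      fix q assume q: "q \<in> ?Q"
      then have "inv\<^bsub>G\<^esub> q \<in> \<gamma> ` ?Q" using im by simp
      then obtain z where "z \<in> ?Q" "\<gamma> z = inv\<^bsub>G\<^esub> q" by auto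
      then show "q \<in> \<delta> ` ?Q" using q by (auto simp: \<delta>_def intro!: image_eqI[of _ _ z])
    qed
  qed (use cl in auto)
  have graph: "f x y = z \<longleftrightarrow> \<alpha> x \<otimes>\<^bsub>G\<^esub> \<beta> y \<otimes>\<^bsub>G\<^esub> \<delta> z = \<one>\<^bsub>G\<^esub>"
    if xyz: "x \<in> ?Q" "y \<in> ?Q" "z \<in> ?Q" for x y z
  proof -
    have m: "\<alpha> x \<otimes>\<^bsub>G\<^esub> \<beta> y \<in> ?Q" using xyz cl by simp
    have "f x y = z \<longleftrightarrow> \<alpha> x \<otimes>\<^bsub>G\<^esub> \<beta> y = \<gamma> z"
      unfolding f[OF xyz(1,2)]
      using bij_betw_inv_into_left[OF \<gamma> xyz(3)] bij_betw_inv_into_right[OF \<gamma> m] by auto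
    also have "\<dots> \<longleftrightarrow> \<alpha> x \<otimes>\<^bsub>G\<^esub> \<beta> y \<otimes>\<^bsub>G\<^esub> \<delta> z = \<one>\<^bsub>G\<^esub>"
      unfolding \<delta>_def using m cl(3)[OF xyz(3)]
      by (metis inv_equality inv_inv inv_closed r_inv)
    finally show ?thesis .
  qed
  have graph': "f x y = z \<longleftrightarrow> \<beta> y \<otimes>\<^bsub>G\<^esub> \<delta> z \<otimes>\<^bsub>G\<^esub> \<alpha> x = \<one>\<^bsub>G\<^esub>"
    if "x \<in> ?Q" "y \<in> ?Q" "z \<in> ?Q" for x y z
    using graph[OF that] mult_eq_one_rotate[of "\<alpha> x" "\<beta> y" "\<delta> z"] cl that by simp
  have graph'': "f x y = z \<longleftrightarrow> \<delta> z \<otimes>\<^bsub>G\<^esub> \<alpha> x \<otimes>\<^bsub>G\<^esub> \<beta> y = \<one>\<^bsub>G\<^esub>"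
    if "x \<in> ?Q" "y \<in> ?Q" "z \<in> ?Q" for x y z
    using graph'[OF that] mult_eq_one_rotate[of "\<beta> y" "\<delta> z" "\<alpha> x"] cl that by simp
  \<comment> \<open>Evaluating the invariance at an explicit triple \<open>t\<close> makes it a law
    in three variables.\<close>
  have T': "f (t (transpose i j 1)) (t (transpose i j 2)) = t (transpose i j 3) \<longleftrightarrow> f x y = z"
    if "x \<in> ?Q" "y \<in> ?Q" "z \<in> ?Q" "t = (\<lambda>k. if k = 1 then x else if k = 2 then y else z)"
    for x y z and t :: "nat \<Rightarrow> 'a"
    using bspec[OF T, of t] that by (auto simp: Pi_iff)
  \<comment> \<open>In each case the rotation of the graph equation is chosen so that the two
    exchanged coordinates stand in the first two factors: \<open>x\<close>, \<open>y\<close> in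
    \<open>graph\<close>, \<open>z\<close>, \<open>x\<close> in \<open>graph''\<close>, and
    \<open>y\<close>, \<open>z\<close> in \<open>graph'\<close>.\<close>
  consider "i = 1" "j = 2" | "i = 1" "j = 3" | "i = 2" "j = 3" using ij by auto
  then have "comm_group G"
  proof cases
    case 1
    then have "f y x = z \<longleftrightarrow> f x y = z" if "x \<in> ?Q" "y \<in> ?Q" "z \<in> ?Q" for x y z
      using T'[OF that refl] by (simp add: transpose_def)
    then show ?thesis
      by (intro comm_group_if_interchange[of \<alpha> \<beta> \<delta>]) (use im im\<delta> cl graph in auto)
  next
    case 2
    then have "f z y = x \<longleftrightarrow> f x y = z" if "x \<in> ?Q" "y \<in> ?Q" "z \<in> ?Q" for x y z
      using T'[OF that refl] by (simp add: transpose_def)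
    then show ?thesis
      by (intro comm_group_if_interchange[of \<delta> \<alpha> \<beta>]) (use im im\<delta> cl graph'' in auto)
  next
    case 3
    then have "f x z = y \<longleftrightarrow> f x y = z" if "x \<in> ?Q" "y \<in> ?Q" "z \<in> ?Q" for x y z
      using T'[OF that refl] by (simp add: transpose_def)
    then show ?thesis
      by (intro comm_group_if_interchange[of \<beta> \<delta> \<alpha>]) (use im im\<delta> cl graph' in auto)
  qed
  with nc show False ..
qed

theorem corollary9:
  fixes G :: "('a, 'b) monoid_scheme" and f :: "'a \<Rightarrow> 'a \<Rightarrow> 'a"
  assumes "group G" and "\<not> comm_group G" and "group_isotope G f"
  shows "(semi_symmetric (carrier G) f \<or> asymmetric (carrier G) f) \<and>
         \<not> (semi_symmetric (carrier G) f \<and> asymmetric (carrier G) f)"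
proof -
  let ?S = "parastrophic_sym (carrier G) f"
  have Q: "quasigroup (carrier G) f"
    using assms(1,3) by (rule quasigroup_if_group_isotope)
  have id: "id \<in> ?S" using Q by (rule id_in_parastrophic_sym)
  have sub: "?S \<subseteq> {id, cycle3, cycle3_inv}"
  proof
    fix \<sigma> assume \<sigma>: "\<sigma> \<in> ?S"
    then have "\<sigma> permutes {1..3}"
      by (simp add: parastrophic_sym_def sym_group_carrier)
    from permutes_3_cases[OF this] \<sigma> show "\<sigma> \<in> {id, cycle3, cycle3_inv}"
      using transposition_not_in_parastrophic_sym[OF assms] by auto
  qed
  \<comment> \<open>Each 3-cycle is the square of the other, so \<open>?S\<close> contains both or
    neither.\<close>
  have "cycle3 \<in> ?S \<longleftrightarrow> cycle3_inv \<in> ?S"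
    using comp_in_parastrophic_sym[OF Q, of cycle3 cycle3]
      comp_in_parastrophic_sym[OF Q, of cycle3_inv cycle3_inv]
    unfolding cycle3_square by blast
  then have "carrier (alt_group 3) \<subseteq> ?S \<or> ?S = {id}"
    using sub id unfolding alt_group_3 by blast
  \<comment> \<open>Exclusivity: \<open>cycle3\<close> moves 1, so the alternating group is not
    contained in \<open>{id}\<close>.\<close>
  moreover have "cycle3 1 \<noteq> id 1" by (simp add: transpose_def)
  then have "cycle3 \<noteq> id" by metis
  then have "\<not> carrier (alt_group 3) \<subseteq> {id}"
    unfolding alt_group_3 by blast
  ultimately show ?thesis
    using Q unfolding semi_symmetric_def asymmetric_def by auto
qed

end
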